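(* Let $\mathbb{B}_0=(X_1,X_2,X_3)$ be the basis of $\mathrm{sl}(2,\mathbb{R})$ with $[X_1,X_2]=2X_3$, $[X_3,X_1]=2X_2$, $[X_3,X_2]=2X_1$. Let $v>0$ and $-v<u<v$, and consider the left invariant metric on $\widetilde{\mathrm{PSL}}(2,\mathbb{R})$ with matrix in $\mathbb{B}_0$ $$\frac{16}{v^2-u^2}\begin{pmatrix} u & 0 & v \\ 0 & 2(u+v) & 0 \\ v & 0 & u \end{pmatrix}.$$ Its Ricci curvature and scalar curvature are $$M(\mathrm{ric},\mathbb{B}_0)=\begin{pmatrix}\frac{4v}{v-u}&0&\frac{4v}{v-u}\\0&\frac{16v}{u-v}&0\\ \frac{4v}{v-u}&0&\frac{4(v-2u)}{u-v}\end{pmatrix},\qquad\mathfrak{s}=\frac u2.$$ The signature of $\mathrm{ric}$ is $(+,-,-)$.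
   Context: $\widetilde{\mathrm{PSL}}(2,\mathbb{R})$ is the universal covering group of $\mathrm{SL}(2,\mathbb{R})$. A left invariant metric on a Lie group with Lie algebra $\mathfrak{g}$ is identified with a nondegenerate symmetric bilinear form $\langle\,,\rangle$ on $\mathfrak{g}$. The Levi-Civita product $\mathrm{L}:\mathfrak{g}\times\mathfrak{g}\to\mathfrak{g}$ is given by $2\langle\mathrm{L}_uv,w\rangle=\langle[u,v],w\rangle+\langle[w,u],v\rangle+\langle[w,v],u\rangle$, the curvature by $\mathrm{K}(u,v)=\mathrm{L}_{[u,v]}-[\mathrm{L}_u,\mathrm{L}_v]$, the Ricci tensor by $\mathrm{ric}(u,v)=\mathrm{tr}(w\mapsto\mathrm{K}(u,w)v)$, the Ricci operator by $\langle\mathrm{Ric}(u),v\rangle=\mathrm{ric}(u,v)$, and the scalar curvature by $\mathfrak{s}=\mathrm{tr}(\mathrm{Ric})$. $M(\mathrm{ric},\mathbb{B}_0)$ is the Gram matrix of $\mathrm{ric}$ in $\mathbb{B}_0$. The signature of $\mathrm{ric}$ is its signature as a symmetric bilinear form (signs listed in any order). *)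

theory Defs
  imports "HOL-Analysis.Analysis" "HOL-Library.Multiset"
begin

class real_lie_algebra = real_vector +
  fixes bracket :: "'a \<Rightarrow> 'a \<Rightarrow> 'a"
  assumes bracket_add_left: "bracket (x + y) z = bracket x z + bracket y z"
    and bracket_scaleR_left: "bracket (c *\<^sub>R x) z = c *\<^sub>R bracket x z"
    and bracket_self: "bracket x x = 0"
    and bracket_add_right: "bracket z (x + y) = bracket z x + bracket z y"
    and bracket_jacobi:
      "bracket x (bracket y z) + bracket y (bracket z x) + bracket z (bracket x y) = 0"

typedef sl2 = "{A :: real^2^2. trace A = 0}"
  morphisms mat_of_sl2 sl2_of_mat
  by (rule exI[of _ 0]) (simp add: trace_def)

setup_lifting type_definition_sl2

instantiation sl2 :: real_vector
begin

lift_definition zero_sl2 :: sl2 is 0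
  by (simp add: trace_def)

lift_definition plus_sl2 :: "sl2 \<Rightarrow> sl2 \<Rightarrow> sl2" is "(+)"
  by (simp add: trace_add)

lift_definition uminus_sl2 :: "sl2 \<Rightarrow> sl2" is uminus
  by (simp add: trace_def sum_negf)

lift_definition minus_sl2 :: "sl2 \<Rightarrow> sl2 \<Rightarrow> sl2" is "(-)"
  by (simp add: trace_sub)

lift_definition scaleR_sl2 :: "real \<Rightarrow> sl2 \<Rightarrow> sl2" is "scaleR"
  by (simp add: trace_def flip: sum_distrib_left)

instance
  by standard (transfer; simp add: algebra_simps)+

end

instantiation sl2 :: real_lie_algebra
begin

lift_definition bracket_sl2 :: "sl2 \<Rightarrow> sl2 \<Rightarrow> sl2" is "\<lambda>A B. A ** B - B ** A"
proof -
  fix A B :: "real^2^2"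
  show "trace (A ** B - B ** A) = 0"
    using trace_mul_sym[of A B] by (simp add: trace_sub)
qed

instance
  by standard
    (transfer, simp add: vec_eq_iff forall_2 matrix_matrix_mult_def sum_2 algebra_simps)+

end

definition is_basis :: "'a::real_vector ^ 'n \<Rightarrow> bool" where
  "is_basis e \<longleftrightarrow> inj (($) e) \<and> independent (range (($) e)) \<and> span (range (($) e)) = UNIV"

definition gram_matrix :: "('a \<Rightarrow> 'a \<Rightarrow> real) \<Rightarrow> 'a ^ 'n \<Rightarrow> real ^ 'n ^ 'n" where
  "gram_matrix b e = (\<chi> i j. b (e $ i) (e $ j))"

(* Trace of an endomorphism of a finite-dimensional space: the sum of the diagonal
   coefficients in some basis, the choice of which is immaterial. *)
definition endo_trace :: "('a::real_vector \<Rightarrow> 'a) \<Rightarrow> real" where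
  "endo_trace f =
     (let B = (SOME B. independent B \<and> span B = UNIV) in \<Sum>b\<in>B. representation B (f b) b)"

(* A left invariant (pseudo-Riemannian) metric on a Lie group is identified with its value at
   the identity, a form on the Lie algebra 'a. *)
definition left_invariant_metric :: "('a::real_lie_algebra \<Rightarrow> 'a \<Rightarrow> real) \<Rightarrow> bool" where
  "left_invariant_metric g \<longleftrightarrow>
     bilinear g \<and> (\<forall>x y. g x y = g y x) \<and> (\<forall>x. (\<forall>y. g x y = 0) \<longrightarrow> x = 0)"

definition levi_civita ::
  "('a::real_lie_algebra \<Rightarrow> 'a \<Rightarrow> real) \<Rightarrow> 'a \<Rightarrow> 'a \<Rightarrow> 'a" where
  "levi_civita g u v =
     (THE z. \<forall>w. 2 * g z w = g (bracket u v) w + g (bracket w u) v + g (bracket w v) u)"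

definition curvature ::
  "('a::real_lie_algebra \<Rightarrow> 'a \<Rightarrow> real) \<Rightarrow> 'a \<Rightarrow> 'a \<Rightarrow> 'a \<Rightarrow> 'a" where
  "curvature g u v w =
     levi_civita g (bracket u v) w
     - (levi_civita g u (levi_civita g v w) - levi_civita g v (levi_civita g u w))"

definition ricci :: "('a::real_lie_algebra \<Rightarrow> 'a \<Rightarrow> real) \<Rightarrow> 'a \<Rightarrow> 'a \<Rightarrow> real" where
  "ricci g u v = endo_trace (\<lambda>w. curvature g u w v)"

definition ricci_operator :: "('a::real_lie_algebra \<Rightarrow> 'a \<Rightarrow> real) \<Rightarrow> 'a \<Rightarrow> 'a" where
  "ricci_operator g u = (THE z. \<forall>v. g z v = ricci g u v)"

definition scalar_curvature :: "('a::real_lie_algebra \<Rightarrow> 'a \<Rightarrow> real) \<Rightarrow> real" where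
  "scalar_curvature g = endo_trace (ricci_operator g)"

(* The signature of a symmetric bilinear form is the multiset of the signs (1, -1 or 0) on the
   diagonal of its matrix in an orthogonal basis; by Sylvester's law of inertia it does not
   depend on that basis. *)
definition has_signature :: "('a::real_vector \<Rightarrow> 'a \<Rightarrow> real) \<Rightarrow> real multiset \<Rightarrow> bool" where
  "has_signature b S \<longleftrightarrow> bilinear b \<and> (\<forall>x y. b x y = b y x) \<and>
     (\<exists>E. finite E \<and> independent E \<and> span E = UNIV \<and>
          (\<forall>x\<in>E. \<forall>y\<in>E. x \<noteq> y \<longrightarrow> b x y = 0) \<and>
          S = image_mset (\<lambda>x. sgn (b x x)) (mset_set E))"

(* The bracket relations determine the basis only up to an automorphism of sl2. *)
definition sl2_standard_basis :: "sl2 ^ 3 \<Rightarrow> bool" where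
  "sl2_standard_basis X \<longleftrightarrow> is_basis X \<and>
     bracket (X $ 1) (X $ 2) = 2 *\<^sub>R X $ 3 \<and>
     bracket (X $ 3) (X $ 1) = 2 *\<^sub>R X $ 2 \<and>
     bracket (X $ 3) (X $ 2) = 2 *\<^sub>R X $ 1"

lemma sl2_standard_basis_exists: "\<exists>X. sl2_standard_basis X"
proof -
  define X1 where "X1 = sl2_of_mat (vector [vector [0, 1], vector [-1, 0]])"
  define X2 where "X2 = sl2_of_mat (vector [vector [0, 1], vector [1, 0]])"
  define X3 where "X3 = sl2_of_mat (vector [vector [1, 0], vector [0, -1]])"
  have m1: "mat_of_sl2 X1 = vector [vector [0, 1], vector [-1, 0]]"
    unfolding X1_def by (rule sl2_of_mat_inverse) (simp add: trace_def sum_2)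
  have m2: "mat_of_sl2 X2 = vector [vector [0, 1], vector [1, 0]]"
    unfolding X2_def by (rule sl2_of_mat_inverse) (simp add: trace_def sum_2)
  have m3: "mat_of_sl2 X3 = vector [vector [1, 0], vector [0, -1]]"
    unfolding X3_def by (rule sl2_of_mat_inverse) (simp add: trace_def sum_2)
  note ext = mat_of_sl2_inject[symmetric] vec_eq_iff forall_2
  note rep = bracket_sl2.rep_eq scaleR_sl2.rep_eq plus_sl2.rep_eq zero_sl2.rep_eq m1 m2 m3
  define X :: "sl2 ^ 3" where "X = vector [X1, X2, X3]"
  have X: "X $ 1 = X1" "X $ 2 = X2" "X $ 3 = X3"
    by (simp_all add: X_def)
  have ne: "X1 \<noteq> X2" "X1 \<noteq> X3" "X2 \<noteq> X3"
    by (simp_all add: ext rep)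
  have R: "range (($) X) = {X1, X2, X3}"
    by (auto simp: image_def UNIV_3 X)
  have inj: "inj (($) X)"
    using ne by (auto simp: inj_def forall_3 X)
  have lin: "a = 0 \<and> b = 0 \<and> c = 0" if "a *\<^sub>R X1 + b *\<^sub>R X2 + c *\<^sub>R X3 = 0" for a b c
    using that by (simp add: ext rep)
  have ind: "independent {X1, X2, X3}"
  proof (rule independent_if_scalars_zero)
    fix f x assume s: "(\<Sum>x\<in>{X1, X2, X3}. f x *\<^sub>R x) = 0" and x: "x \<in> {X1, X2, X3}"
    from s ne have "f X1 *\<^sub>R X1 + f X2 *\<^sub>R X2 + f X3 *\<^sub>R X3 = 0"
      by (simp add: add.assoc)
    from lin[OF this] x show "f x = 0" by auto
  qed simp
  have "A \<in> span {X1, X2, X3}" for A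
  proof -
    let ?M = "mat_of_sl2 A"
    have "trace ?M = 0" using mat_of_sl2[of A] by simp
    then have t: "?M $ 2 $ 2 = - ?M $ 1 $ 1" by (simp add: trace_def sum_2)
    have "A = ((?M $ 1 $ 2 - ?M $ 2 $ 1) / 2) *\<^sub>R X1 + ((?M $ 1 $ 2 + ?M $ 2 $ 1) / 2) *\<^sub>R X2
      + (?M $ 1 $ 1) *\<^sub>R X3"
      by (simp add: ext rep t field_simps)
    moreover have "\<dots> \<in> span {X1, X2, X3}"
      by (intro span_add span_scale span_base) auto
    ultimately show ?thesis by metis
  qed
  then have "span {X1, X2, X3} = UNIV" by auto
  with inj ind have "is_basis X" by (simp add: is_basis_def R)
  moreover have "bracket X1 X2 = 2 *\<^sub>R X3" "bracket X3 X1 = 2 *\<^sub>R X2"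
      "bracket X3 X2 = 2 *\<^sub>R X1"
    by (simp_all add: ext rep matrix_matrix_mult_def sum_2)
  ultimately have "sl2_standard_basis X"
    by (simp add: sl2_standard_basis_def X)
  then show ?thesis ..
qed

end

theory Submission
  imports Defs
begin

text \<open>
  The Levi-Civita product and the Ricci operator are defined through unique existence; both are
  instances of the fact that a nondegenerate form on a finite-dimensional space represents every
  linear functional, and equality of two linear functionals only has to be tested on a basis. A trace is
  the sum of the diagonal coordinates in any basis, so everything reduces to a computation in
  coordinates, rational in \<open>p = v - u\<close> and \<open>q = v + u\<close>. The signature is read off from the
  orthogonal basis \<open>X\<^sub>1, X\<^sub>2, X\<^sub>3 - X\<^sub>1\<close>, on which the Ricci form takes the values
  \<open>4v/p\<close>, \<open>-16v/p\<close> and \<open>-8\<close>.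
\<close>

section \<open>Coordinates and traces\<close>

text \<open>The dual basis, indexed by positions instead of basis vectors. It is used only under
  \<open>is_basis e\<close>, where injectivity of \<open>($) e\<close> makes the two indexings
  agree.\<close>

definition coord :: "'a::real_vector ^ 'n \<Rightarrow> 'n \<Rightarrow> 'a \<Rightarrow> real" where
  "coord e i x = representation (range (($) e)) x (e $ i)"

lemma linear_coord:
  assumes "is_basis e"
  shows "linear (coord e i)"
  using assms unfolding is_basis_def
  by (intro linearI) (simp_all add: coord_def real_vector.representation_add real_vector.representation_scale)

lemma coord_basis:
  assumes "is_basis e"
  shows "coord e i (e $ j) = (if i = j then 1 else 0)"
proof -
  have "representation (range (($) e)) (e $ j) = (\<lambda>v. if v = e $ j then 1 else 0)"
    using assms by (intro real_vector.representation_basis) (auto simp: is_basis_def)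
  then show ?thesis
    using assms by (auto simp: coord_def is_basis_def inj_def)
qed

lemma sum_coord_scaleR:
  assumes "is_basis e"
  shows "(\<Sum>i\<in>UNIV. coord e i x *\<^sub>R e $ i) = x"
proof -
  have "(\<Sum>b\<in>range (($) e). representation (range (($) e)) x b *\<^sub>R b) = x"
    using assms by (intro real_vector.sum_representation_eq) (auto simp: is_basis_def)
  then show ?thesis
    using assms by (simp add: is_basis_def coord_def sum.reindex)
qed

lemma linear_eq_on_is_basis:
  assumes "is_basis e" "linear f" "linear h" "\<And>i. f (e $ i) = h (e $ i)"
  shows "f x = h x"
  using real_vector.linear_eq_on_span[OF assms(2,3), of "range (($) e)" x] assms(1,4)
  by (auto simp: is_basis_def)

text \<open>This is tr(PQ) = tr(QP) for a change of basis. Expanding each \<open>f b\<close> over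
  the images of \<open>C\<close> gives a double sum; after exchanging the sums, the inner one
  re-expands \<open>f c\<close> through \<open>B\<close> and leaves its own
  \<open>C\<close>-coefficient.\<close>

lemma sum_representation_basis_change:
  fixes f :: "'a::real_vector \<Rightarrow> 'a"
  assumes B: "finite B" "independent B" "span B = UNIV"
    and C: "finite C" "independent C" "span C = UNIV"
    and f: "linear f"
  shows "(\<Sum>b\<in>B. representation B (f b) b) = (\<Sum>c\<in>C. representation C (f c) c)"
proof -
  have expand: "representation D (f x) d
      = (\<Sum>c\<in>C. representation C x c * representation D (f c) d)"
    if D: "independent D" "span D = UNIV" for D x d
  proof -
    have "f x = f (\<Sum>c\<in>C. representation C x c *\<^sub>R c)"
      using C by (simp add: real_vector.sum_representation_eq)
    also have "\<dots> = (\<Sum>c\<in>C. representation C x c *\<^sub>R f c)"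
      using f by (simp add: linear_sum linear_scale)
    finally show ?thesis
      using D by (simp add: real_vector.representation_sum real_vector.representation_scale)
  qed
  have expandB: "representation C y c = (\<Sum>b\<in>B. representation B y b * representation C b c)"
    for y c
  proof -
    have "representation C y c = representation C (\<Sum>b\<in>B. representation B y b *\<^sub>R b) c"
      using B by (simp add: real_vector.sum_representation_eq)
    then show ?thesis
      using C by (simp add: real_vector.representation_sum real_vector.representation_scale)
  qed
  have "(\<Sum>b\<in>B. representation B (f b) b)
      = (\<Sum>b\<in>B. \<Sum>c\<in>C. representation C b c * representation B (f c) b)"
    by (intro sum.cong refl expand B)
  also have "\<dots> = (\<Sum>c\<in>C. \<Sum>b\<in>B. representation B (f c) b * representation C b c)"
    by (subst sum.swap) (simp add: mult.commute)
  also have "\<dots> = (\<Sum>c\<in>C. representation C (f c) c)"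
    by (intro sum.cong refl expandB[symmetric])
  finally show ?thesis .
qed

lemma endo_trace_eq_sum_coord:
  fixes e :: "'a::real_vector ^ 'n"
  assumes e: "is_basis e" and f: "linear f"
  shows "endo_trace f = (\<Sum>i\<in>UNIV. coord e i (f (e $ i)))"
proof -
  let ?C = "range (($) e)"
  define B :: "'a set" where "B = (SOME B. independent B \<and> span B = UNIV)"
  have C: "finite ?C" "independent ?C" "span ?C = UNIV"
    using e by (auto simp: is_basis_def)
  have B: "independent B \<and> span B = UNIV"
    unfolding B_def by (rule someI[of _ ?C]) (use C in auto)
  \<comment> \<open>The basis picked by \<open>SOME\<close> is only known to be independent and
    spanning. Finiteness follows because it is an independent set inside the span of the finite set
    \<open>?C\<close>.\<close>
  then have "finite B"
    using real_vector.independent_span_bound[OF C(1), of B] C(3) by auto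
  with B C f have "endo_trace f = (\<Sum>c\<in>?C. representation ?C (f c) c)"
    unfolding endo_trace_def Let_def B_def[symmetric]
    by (intro sum_representation_basis_change) auto
  also have "\<dots> = (\<Sum>i\<in>UNIV. coord e i (f (e $ i)))"
    using e by (simp add: is_basis_def sum.reindex coord_def)
  finally show ?thesis .
qed

section \<open>Curvature of a left invariant metric\<close>

lemma bracket_anticommute: "bracket x y = - bracket y (x::'a::real_lie_algebra)"
proof -
  have "0 = bracket (x + y) (x + y)"
    by (simp add: bracket_self)
  also have "\<dots> = bracket x y + bracket y x"
    unfolding bracket_add_left bracket_add_right by (simp add: bracket_self)
  finally show ?thesis
    by (metis add_eq_0_iff2)
qed

lemma bilinear_bracket: "bilinear (bracket :: 'a::real_lie_algebra \<Rightarrow> _)"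
proof -
  \<comment> \<open>Homogeneity in the right slot is obtained from the left slot by two uses of
    antisymmetry.\<close>
  have "bracket z (c *\<^sub>R x) = c *\<^sub>R bracket z x" for z x :: 'a and c
    using bracket_scaleR_left[of c x z] bracket_anticommute[of z] by (metis scaleR_minus_right)
  then show ?thesis
    unfolding bilinear_def
    by (auto intro!: linearI simp: bracket_add_left bracket_add_right bracket_scaleR_left)
qed

section \<open>Metrics and the functionals they represent\<close>

lemma left_invariant_metricD:
  assumes "left_invariant_metric g"
  shows "bilinear g" "g x y = g y x" "(\<And>y. g x y = 0) \<Longrightarrow> x = 0"
  using assms by (auto simp: left_invariant_metric_def)

lemma left_invariant_metric_cancel:
  assumes "left_invariant_metric g" "\<And>w. g x w = g y w"
  shows "x = y"
  using left_invariant_metricD(3)[OF assms(1), of "x - y"] assms(2)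
    bilinear_lsub[OF left_invariant_metricD(1)[OF assms(1)]]
  by simp

text \<open>A dimension count: \<open>h\<close> sends a coordinate vector to the values of the
  metric functional on the basis. Nondegeneracy makes this endomorphism of \<open>real ^ 'n\<close>
  injective, hence surjective, so the basis values of \<open>\<phi>\<close> are attained. Uniqueness
  is nondegeneracy again.\<close>

lemma metric_represents_linear:
  fixes e :: "'a::real_lie_algebra ^ 'n" and g :: "'a \<Rightarrow> 'a \<Rightarrow> real"
  assumes e: "is_basis e" and g: "left_invariant_metric g" and \<phi>: "linear \<phi>"
  shows "\<exists>!z. \<forall>w. g z w = \<phi> w"
proof -
  note bil = left_invariant_metricD(1)[OF g]
  define vec where "vec c = (\<Sum>i\<in>UNIV. (c :: real ^ 'n) $ i *\<^sub>R e $ i)" for c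
  define h where "h c = (\<chi> j. g (vec c) (e $ j))" for c :: "real ^ 'n"
  have lin_vec: "linear vec"
    unfolding vec_def
    by (intro linearI) (simp_all add: scaleR_add_left sum.distrib scaleR_sum_right)
  have lin_h: "linear h"
    by (intro linearI)
      (simp_all add: h_def vec_eq_iff linear_add[OF lin_vec] linear_scale[OF lin_vec]
        bilinear_ladd[OF bil] bilinear_lmul[OF bil])
  have eqI: "g z w = \<psi> w" if "linear \<psi>" "\<And>i. g z (e $ i) = \<psi> (e $ i)" for z w \<psi>
    using linear_eq_on_is_basis[OF e _ that(1), of "g z"] bil that(2) by (auto simp: bilinear_def)
  have "inj h"
    unfolding linear_injective_0[OF lin_h]
  proof (intro allI impI)
    fix c assume "h c = 0"
    then have "g (vec c) (e $ i) = 0" for i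
      by (simp add: h_def vec_eq_iff)
    then have "g (vec c) w = 0" for w
      using eqI[OF linear_zero] by blast
    then have "vec c = 0"
      using left_invariant_metricD(3)[OF g] by blast
    moreover have "coord e i (vec c) = c $ i" for i
      by (simp add: vec_def linear_sum[OF linear_coord[OF e]]
          linear_scale[OF linear_coord[OF e]] coord_basis[OF e] if_distrib cong: if_cong)
    moreover have "coord e i 0 = 0" for i
      by (rule linear_0[OF linear_coord[OF e]])
    ultimately have "c $ i = 0" for i
      by metis
    then show "c = 0"
      by (simp add: vec_eq_iff)
  qed
  then have "surj h"
    using lin_h by (intro linear_injective_imp_surjective) simp_all
  then obtain c where c: "h c = (\<chi> j. \<phi> (e $ j))"
    by (metis surjD)
  then have "g (vec c) (e $ j) = \<phi> (e $ j)" for j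
    by (simp add: h_def vec_eq_iff)
  then have "g (vec c) w = \<phi> w" for w
    using eqI[OF \<phi>] by blast
  then show ?thesis
    using left_invariant_metric_cancel[OF g] by (intro ex1I[of _ "vec c"]) auto
qed

text \<open>Half of the right-hand side is linear in \<open>w\<close>, so the metric represents it
  by exactly one vector and the \<open>THE\<close> in \<open>levi_civita\<close> is well
  defined.\<close>

lemma levi_civita_koszul:
  fixes e :: "'a::real_lie_algebra ^ 'n" and g :: "'a \<Rightarrow> 'a \<Rightarrow> real"
  assumes e: "is_basis e" and g: "left_invariant_metric g"
  shows "2 * g (levi_civita g x y) w
    = g (bracket x y) w + g (bracket w x) y + g (bracket w y) x"
proof -
  note bil = left_invariant_metricD(1)[OF g]
  let ?\<phi> = "\<lambda>w. (g (bracket x y) w + g (bracket w x) y + g (bracket w y) x) / 2"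
  have "linear ?\<phi>"
    by (intro linearI)
      (simp_all add: bilinear_ladd[OF bil] bilinear_radd[OF bil] bilinear_lmul[OF bil]
        bilinear_rmul[OF bil] bilinear_ladd[OF bilinear_bracket]
        bilinear_lmul[OF bilinear_bracket] field_simps)
  from metric_represents_linear[OF e g this]
  have "\<exists>!z. \<forall>w. 2 * g z w = g (bracket x y) w + g (bracket w x) y + g (bracket w y) x"
    by (simp add: field_simps)
  from theI'[OF this] show ?thesis
    by (simp add: levi_civita_def)
qed

lemma levi_civita_eqI:
  fixes e :: "'a::real_lie_algebra ^ 'n" and g :: "'a \<Rightarrow> 'a \<Rightarrow> real"
  assumes e: "is_basis e" and g: "left_invariant_metric g"
    and z: "\<And>i. 2 * g z (e $ i)
      = g (bracket x y) (e $ i) + g (bracket (e $ i) x) y + g (bracket (e $ i) y) x"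
  shows "levi_civita g x y = z"
proof (rule left_invariant_metric_cancel[OF g])
  show "g (levi_civita g x y) w = g z w" for w
  proof (rule linear_eq_on_is_basis[OF e])
    show "g (levi_civita g x y) (e $ i) = g z (e $ i)" for i
      using levi_civita_koszul[OF e g, of x y "e $ i"] z[of i] by simp
  qed (use left_invariant_metricD(1)[OF g] in \<open>auto simp: bilinear_def\<close>)
qed

lemma bilinear_levi_civita:
  fixes e :: "'a::real_lie_algebra ^ 'n" and g :: "'a \<Rightarrow> 'a \<Rightarrow> real"
  assumes e: "is_basis e" and g: "left_invariant_metric g"
  shows "bilinear (levi_civita g)"
proof -
  note bil = left_invariant_metricD(1)[OF g]
  have koszul: "g (levi_civita g x y) w
      = (g (bracket x y) w + g (bracket w x) y + g (bracket w y) x) / 2" for x y w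
    using levi_civita_koszul[OF e g, of x y w] by simp
  note expand = koszul bilinear_ladd[OF bil] bilinear_radd[OF bil]
    bilinear_lmul[OF bil] bilinear_rmul[OF bil] bilinear_ladd[OF bilinear_bracket]
    bilinear_radd[OF bilinear_bracket] bilinear_lmul[OF bilinear_bracket]
    bilinear_rmul[OF bilinear_bracket]
  show ?thesis
    unfolding bilinear_def
    \<comment> \<open>Each linearity law is a claim that a given vector is a Levi-Civita product. By
      uniqueness it suffices to test it in the metric, where the Koszul formula leaves a polynomial
      identity between real numbers.\<close>
    by (intro conjI allI linearI; rule levi_civita_eqI[OF e g];
        simp only: expand real_scaleR_def; algebra)
qed

text \<open>Linearity in the second slot allows the Ricci trace to be computed in any basis; the
  other two slots give bilinearity of \<open>ricci g\<close>.\<close>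

lemma linear_curvature:
  fixes e :: "'a::real_lie_algebra ^ 'n" and g :: "'a \<Rightarrow> 'a \<Rightarrow> real"
  assumes e: "is_basis e" and g: "left_invariant_metric g"
  shows "linear (\<lambda>x. curvature g x y z)" "linear (\<lambda>y. curvature g x y z)"
    "linear (\<lambda>z. curvature g x y z)"
proof -
  note bil = bilinear_levi_civita[OF e g]
  note expand = curvature_def bilinear_ladd[OF bil] bilinear_radd[OF bil]
    bilinear_lmul[OF bil] bilinear_rmul[OF bil] bilinear_ladd[OF bilinear_bracket]
    bilinear_radd[OF bilinear_bracket] bilinear_lmul[OF bilinear_bracket]
    bilinear_rmul[OF bilinear_bracket]
  show "linear (\<lambda>x. curvature g x y z)" "linear (\<lambda>y. curvature g x y z)"
    "linear (\<lambda>z. curvature g x y z)"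
    by (rule linearI; simp only: expand; simp add: algebra_simps)+
qed

lemma ricci_eq_sum_coord:
  fixes e :: "'a::real_lie_algebra ^ 'n" and g :: "'a \<Rightarrow> 'a \<Rightarrow> real"
  assumes e: "is_basis e" and g: "left_invariant_metric g"
  shows "ricci g x y = (\<Sum>i\<in>UNIV. coord e i (curvature g x (e $ i) y))"
  unfolding ricci_def by (rule endo_trace_eq_sum_coord[OF e linear_curvature(2)[OF e g]])

lemma bilinear_ricci:
  fixes e :: "'a::real_lie_algebra ^ 'n" and g :: "'a \<Rightarrow> 'a \<Rightarrow> real"
  assumes e: "is_basis e" and g: "left_invariant_metric g"
  shows "bilinear (ricci g)"
  unfolding bilinear_def ricci_eq_sum_coord[OF e g]
  using linear_compose[OF linear_curvature(1)[OF e g] linear_coord[OF e]]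
    linear_compose[OF linear_curvature(3)[OF e g] linear_coord[OF e]]
  by (auto intro!: linear_compose_sum simp: o_def)

lemma ricci_operator_works:
  fixes e :: "'a::real_lie_algebra ^ 'n" and g :: "'a \<Rightarrow> 'a \<Rightarrow> real"
  assumes e: "is_basis e" and g: "left_invariant_metric g"
  shows "g (ricci_operator g x) w = ricci g x w"
proof -
  have "linear (ricci g x)"
    using bilinear_ricci[OF e g] by (simp add: bilinear_def)
  from theI'[OF metric_represents_linear[OF e g this]] show ?thesis
    by (simp add: ricci_operator_def)
qed

lemma ricci_operator_eqI:
  fixes e :: "'a::real_lie_algebra ^ 'n" and g :: "'a \<Rightarrow> 'a \<Rightarrow> real"
  assumes e: "is_basis e" and g: "left_invariant_metric g"
    and z: "\<And>i. g z (e $ i) = ricci g x (e $ i)"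
  shows "ricci_operator g x = z"
proof (rule left_invariant_metric_cancel[OF g])
  show "g (ricci_operator g x) w = g z w" for w
  proof (rule linear_eq_on_is_basis[OF e])
    show "g (ricci_operator g x) (e $ i) = g z (e $ i)" for i
      by (simp add: ricci_operator_works[OF e g] z)
  qed (use left_invariant_metricD(1)[OF g] in \<open>auto simp: bilinear_def\<close>)
qed

lemma linear_ricci_operator:
  fixes e :: "'a::real_lie_algebra ^ 'n" and g :: "'a \<Rightarrow> 'a \<Rightarrow> real"
  assumes e: "is_basis e" and g: "left_invariant_metric g"
  shows "linear (ricci_operator g)"
proof -
  note bil = left_invariant_metricD(1)[OF g] and ric = bilinear_ricci[OF e g]
  show ?thesis
    by (intro linearI; rule ricci_operator_eqI[OF e g])
      (simp_all add: ricci_operator_works[OF e g] bilinear_ladd[OF bil] bilinear_lmul[OF bil]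
        bilinear_ladd[OF ric] bilinear_lmul[OF ric])
qed

text \<open>Two linear extensions, one per argument. It serves both the metric and the Ricci form,
  whose symmetry is read off their matrices.\<close>

lemma bilinear_symmetric_on_basis:
  fixes b :: "'a::real_vector \<Rightarrow> 'a \<Rightarrow> real"
  assumes e: "is_basis e" and b: "bilinear b"
    and sym: "\<And>i j. b (e $ i) (e $ j) = b (e $ j) (e $ i)"
  shows "b x y = b y x"
proof -
  have lin: "linear (b z)" "linear (\<lambda>x. b x z)" for z
    using b by (auto simp: bilinear_def)
  have "b (e $ i) y = b y (e $ i)" for i y
    by (rule linear_eq_on_is_basis[OF e lin]) (rule sym)
  then show ?thesis
    by (rule linear_eq_on_is_basis[OF e lin(2) lin(1)])
qed

section \<open>The metric on the special linear algebra\<close>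

theorem proposition4p7:
  fixes X :: "sl2 ^ 3" and u v :: real and g :: "sl2 \<Rightarrow> sl2 \<Rightarrow> real"
  assumes "sl2_standard_basis X"
    and "v > 0" and "- v < u" and "u < v"
    and "bilinear g"
    and "gram_matrix g X =
           (16 / (v\<^sup>2 - u\<^sup>2)) *\<^sub>R
           vector [vector [u, 0, v],
                   vector [0, 2 * (u + v), 0],
                   vector [v, 0, u]]"
  shows "left_invariant_metric g \<and>
         gram_matrix (ricci g) X =
           vector [vector [4 * v / (v - u), 0, 4 * v / (v - u)],
                   vector [0, 16 * v / (u - v), 0],
                   vector [4 * v / (v - u), 0, 4 * (v - 2 * u) / (u - v)]] \<and>
         scalar_curvature g = u / 2 \<and>
         has_signature (ricci g) {#1, -1, -1#}"
proof -
  have X: "is_basis X"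
    and br: "bracket (X $ 1) (X $ 2) = 2 *\<^sub>R X $ 3" "bracket (X $ 3) (X $ 1) = 2 *\<^sub>R X $ 2"
      "bracket (X $ 3) (X $ 2) = 2 *\<^sub>R X $ 1"
    using assms(1) by (auto simp: sl2_standard_basis_def)
  have br': "bracket (X $ 2) (X $ 1) = - (2 *\<^sub>R X $ 3)" "bracket (X $ 1) (X $ 3) = - (2 *\<^sub>R X $ 2)"
      "bracket (X $ 2) (X $ 3) = - (2 *\<^sub>R X $ 1)"
    using br bracket_anticommute by metis+
  \<comment> \<open>\<open>p\<close> and \<open>q\<close> are the factors of
    \<open>v\<^sup>2 - u\<^sup>2\<close>, and the bounds on \<open>u\<close> say exactly that both
    are positive.\<close>
  define p where "p = v - u"
  define q where "q = v + u"
  have pq: "p > 0" "q > 0" and uv: "u = (q - p) / 2" "v = (p + q) / 2"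
    using assms(3,4) by (auto simp: p_def q_def)
  have vu2: "v\<^sup>2 - u\<^sup>2 = p * q"
    by (simp add: p_def q_def power2_eq_square algebra_simps)
  \<comment> \<open>Half the scalar factor of the metric, so that the halves in \<open>uv\<close>
    cancel and the entries become \<open>k\<close> times integer combinations of \<open>p\<close>
    and \<open>q\<close>.\<close>
  define k where "k = 8 / (p * q)"
  have ne: "p \<noteq> 0" "q \<noteq> 0" "k \<noteq> 0"
    using pq by (simp_all add: k_def)
  have entry: "gram_matrix g X $ i $ j = g (X $ i) (X $ j)" for i j
    by (simp add: gram_matrix_def)
  have gX: "g (X $ 1) (X $ 1) = k * (q - p)" "g (X $ 1) (X $ 2) = 0"
      "g (X $ 1) (X $ 3) = k * (p + q)" "g (X $ 2) (X $ 1) = 0"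
      "g (X $ 2) (X $ 2) = 4 * k * q" "g (X $ 2) (X $ 3) = 0"
      "g (X $ 3) (X $ 1) = k * (p + q)" "g (X $ 3) (X $ 2) = 0"
      "g (X $ 3) (X $ 3) = k * (q - p)"
    unfolding entry[symmetric] assms(6) vu2 using ne by (simp_all add: uv k_def field_simps)
  note g_lin = bilinear_ladd[OF assms(5)] bilinear_radd[OF assms(5)]
    bilinear_lsub[OF assms(5)] bilinear_rsub[OF assms(5)]
    bilinear_lneg[OF assms(5)] bilinear_rneg[OF assms(5)]
    bilinear_lmul[OF assms(5)] bilinear_rmul[OF assms(5)]
    bilinear_lzero[OF assms(5)] bilinear_rzero[OF assms(5)]
  have decomp: "x = coord X 1 x *\<^sub>R X $ 1 + coord X 2 x *\<^sub>R X $ 2 + coord X 3 x *\<^sub>R X $ 3" for x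
    using sum_coord_scaleR[OF X, of x, symmetric] unfolding sum_3 .
  have g_sym: "g x y = g y x" for x y
  proof (rule bilinear_symmetric_on_basis[OF X assms(5)])
    have "\<forall>i j. g (X $ i) (X $ j) = g (X $ j) (X $ i)"
      by (simp add: forall_3 gX)
    then show "g (X $ i) (X $ j) = g (X $ j) (X $ i)" for i j
      by blast
  qed

  \<comment> \<open>Nondegeneracy of the metric\<close>
  have nondeg: "x = 0" if x: "\<And>y. g x y = 0" for x
  proof -
    define a b c where "a = coord X 1 x" and "b = coord X 2 x" and "c = coord X 3 x"
    have x_eq: "x = a *\<^sub>R X $ 1 + b *\<^sub>R X $ 2 + c *\<^sub>R X $ 3"
      unfolding a_def b_def c_def by (rule decomp)
    have "g x (X $ 1) = 0" "g x (X $ 2) = 0" "g x (X $ 3) = 0"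
      by (rule x)+
    then have "k * (a * (q - p) + c * (p + q)) = 0" "b = 0" "k * (a * (p + q) + c * (q - p)) = 0"
      using ne by (simp_all add: x_eq g_lin gX algebra_simps)
    then have "a * (q - p) + c * (p + q) = 0" "b = 0" "a * (p + q) + c * (q - p) = 0"
      using ne(3) by (simp_all only: mult_eq_0_iff simp_thms)
    \<comment> \<open>Sum and difference of the first and third equations: the vectors
      \<open>X $ 1 + X $ 3\<close> and \<open>X $ 1 - X $ 3\<close> diagonalize that block of the
      metric.\<close>
    then have "(a + c) * q = 0" "(c - a) * p = 0" "b = 0"
      by (simp_all only: distrib_left distrib_right left_diff_distrib right_diff_distrib simp_thms)
    with pq have "a = 0" "b = 0" "c = 0"
      by auto
    then show ?thesis by (simp add: x_eq)
  qed
  have g: "left_invariant_metric g"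
    using assms(5) g_sym nondeg by (auto simp: left_invariant_metric_def)

  \<comment> \<open>The Levi-Civita product on the basis\<close>
  define L where "L = levi_civita g"
  have L_eqI: "L (X $ i) (X $ j) = z"
    if "\<forall>k. 2 * g z (X $ k) = g (bracket (X $ i) (X $ j)) (X $ k)
      + g (bracket (X $ k) (X $ i)) (X $ j) + g (bracket (X $ k) (X $ j)) (X $ i)" for i j z
    unfolding L_def by (rule levi_civita_eqI[OF X g]) (use that in blast)
  \<comment> \<open>The values solve the Koszul equations against the three basis vectors. Negating
    \<open>X $ 1\<close> and \<open>X $ 3\<close> while fixing \<open>X $ 2\<close> is an isometric
    automorphism; hence products of two vectors from \<open>X $ 1\<close>, \<open>X $ 3\<close> are
    multiples of \<open>X $ 2\<close>, and mixed products with \<open>X $ 2\<close> lie in the span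
    of \<open>X $ 1\<close> and \<open>X $ 3\<close>.\<close>
  have L: "L (X $ 1) (X $ 1) = - (v / q) *\<^sub>R X $ 2"
      "L (X $ 1) (X $ 2) = (2 * v / p) *\<^sub>R X $ 1 + (2 * (v - 2 * u) / p) *\<^sub>R X $ 3"
      "L (X $ 1) (X $ 3) = - ((2 * u + v) / q) *\<^sub>R X $ 2"
      "L (X $ 2) (X $ 1) = (2 * v / p) *\<^sub>R X $ 1 - (2 * u / p) *\<^sub>R X $ 3"
      "L (X $ 2) (X $ 2) = 0"
      "L (X $ 2) (X $ 3) = (2 * u / p) *\<^sub>R X $ 1 - (2 * v / p) *\<^sub>R X $ 3"
      "L (X $ 3) (X $ 1) = (v / q) *\<^sub>R X $ 2"
      "L (X $ 3) (X $ 2) = (2 * v / p) *\<^sub>R X $ 1 - (2 * v / p) *\<^sub>R X $ 3"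
      "L (X $ 3) (X $ 3) = - (v / q) *\<^sub>R X $ 2"
    by (rule L_eqI; simp add: forall_3 br br' bracket_self g_lin gX uv ne; simp add: ne field_simps)+
  note L_bil = bilinear_levi_civita[OF X g, folded L_def]
  note L_lin = bilinear_ladd[OF L_bil] bilinear_radd[OF L_bil]
    bilinear_lsub[OF L_bil] bilinear_rsub[OF L_bil]
    bilinear_lneg[OF L_bil] bilinear_rneg[OF L_bil]
    bilinear_lmul[OF L_bil] bilinear_rmul[OF L_bil]
    bilinear_lzero[OF L_bil] bilinear_rzero[OF L_bil]
  note coord_lin = linear_add[OF linear_coord[OF X]] linear_diff[OF linear_coord[OF X]]
    linear_neg[OF linear_coord[OF X]] linear_scale[OF linear_coord[OF X]]
    linear_0[OF linear_coord[OF X]]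
  have "coord X 1 (X $ 1) = 1" "coord X 1 (X $ 2) = 0" "coord X 1 (X $ 3) = 0"
      "coord X 2 (X $ 1) = 0" "coord X 2 (X $ 2) = 1" "coord X 2 (X $ 3) = 0"
      "coord X 3 (X $ 1) = 0" "coord X 3 (X $ 2) = 0" "coord X 3 (X $ 3) = 1"
    by (simp_all add: coord_basis[OF X])
  note coordX = this coord_lin

  \<comment> \<open>Ricci form, Ricci operator and scalar curvature\<close>
  note ric = ricci_eq_sum_coord[OF X g] sum_3 curvature_def L_def[symmetric]
  have ricX: "ricci g (X $ 1) (X $ 1) = 4 * v / p" "ricci g (X $ 1) (X $ 2) = 0"
      "ricci g (X $ 1) (X $ 3) = 4 * v / p" "ricci g (X $ 2) (X $ 1) = 0"
      "ricci g (X $ 2) (X $ 2) = - (16 * v / p)" "ricci g (X $ 2) (X $ 3) = 0"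
      "ricci g (X $ 3) (X $ 1) = 4 * v / p" "ricci g (X $ 3) (X $ 2) = 0"
      "ricci g (X $ 3) (X $ 3) = - (4 * (v - 2 * u) / p)"
    by (simp add: ric br br' bracket_self L L_lin coordX; simp add: uv ne field_simps)+
  note ric_bil = bilinear_ricci[OF X g]
  have gram: "gram_matrix (ricci g) X =
      vector [vector [4 * v / (v - u), 0, 4 * v / (v - u)],
              vector [0, 16 * v / (u - v), 0],
              vector [4 * v / (v - u), 0, 4 * (v - 2 * u) / (u - v)]]"
    using pq by (simp add: vec_eq_iff forall_3 gram_matrix_def ricX p_def field_simps)
  \<comment> \<open>The columns solve the linear systems
    \<open>g z (X $ k) = ricci g (X $ j) (X $ k)\<close>. Their diagonal coefficients
    \<open>v / 4\<close>, \<open>- (v / 2)\<close> and \<open>u / 2 + v / 4\<close> add up to the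
    scalar curvature.\<close>
  have Ric: "ricci_operator g (X $ 1) = (v / 4) *\<^sub>R X $ 1 + (v / 4) *\<^sub>R X $ 3"
      "ricci_operator g (X $ 2) = - (v / 2) *\<^sub>R X $ 2"
      "ricci_operator g (X $ 3) = - (v / 4) *\<^sub>R X $ 1 + (u / 2 + v / 4) *\<^sub>R X $ 3"
  proof -
    have I: "ricci_operator g (X $ j) = z"
      if "\<forall>k. g z (X $ k) = ricci g (X $ j) (X $ k)" for j z
      by (rule ricci_operator_eqI[OF X g]) (use that in blast)
    show "ricci_operator g (X $ 1) = (v / 4) *\<^sub>R X $ 1 + (v / 4) *\<^sub>R X $ 3"
      "ricci_operator g (X $ 2) = - (v / 2) *\<^sub>R X $ 2"
      "ricci_operator g (X $ 3) = - (v / 4) *\<^sub>R X $ 1 + (u / 2 + v / 4) *\<^sub>R X $ 3"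
      by (rule I; simp add: forall_3 g_lin gX ricX uv k_def ne; simp add: ne field_simps)+
  qed
  have scal: "scalar_curvature g = u / 2"
    unfolding scalar_curvature_def endo_trace_eq_sum_coord[OF X linear_ricci_operator[OF X g]]
    by (simp add: sum_3 Ric coordX)

  \<comment> \<open>Signature of the Ricci form\<close>
  have "has_signature (ricci g) {#1, -1, -1#}"
    unfolding has_signature_def
  \<comment> \<open>One Gram-Schmidt step: \<open>X $ 2\<close> is already orthogonal to the others,
    and since \<open>X $ 1\<close> has equal Ricci values with itself and with \<open>X $ 3\<close>,
    the correction of \<open>X $ 3\<close> is exactly \<open>X $ 1\<close>.\<close>
  proof (intro conjI allI exI[of _ "{X $ 1, X $ 2, X $ 3 - X $ 1}"])
    let ?E = "{X $ 1, X $ 2, X $ 3 - X $ 1}"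
    show "bilinear (ricci g)" by (rule ric_bil)
    show "ricci g x y = ricci g y x" for x y
    proof (rule bilinear_symmetric_on_basis[OF X ric_bil])
      have "\<forall>i j. ricci g (X $ i) (X $ j) = ricci g (X $ j) (X $ i)"
        by (simp add: forall_3 ricX)
      then show "ricci g (X $ i) (X $ j) = ricci g (X $ j) (X $ i)" for i j
        by blast
    qed
    have "coord X 3 (X $ 3 - X $ 1) = 1"
      by (simp add: coordX)
    \<comment> \<open>The first coordinate separates \<open>X $ 1\<close> from \<open>X $ 2\<close>,
      the third separates both from the difference. Distinctness ensures that the set yields three
      signs in the multiset and three terms in the sum below.\<close>
    then have distinct: "X $ 1 \<noteq> X $ 2" "X $ 1 \<noteq> X $ 3 - X $ 1" "X $ 2 \<noteq> X $ 3 - X $ 1"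
      using coordX(1,2,7,8) by auto
    show "independent ?E"
    proof (rule independent_if_scalars_zero)
      fix f x assume s: "(\<Sum>x\<in>?E. f x *\<^sub>R x) = 0" and x: "x \<in> ?E"
      from s have "coord X i (f (X $ 1) *\<^sub>R X $ 1 + f (X $ 2) *\<^sub>R X $ 2
          + f (X $ 3 - X $ 1) *\<^sub>R (X $ 3 - X $ 1)) = 0" for i
        using distinct by (simp add: add.assoc coord_lin(5))
      from this[of 1] this[of 2] this[of 3]
      have "f (X $ 1) = 0" "f (X $ 2) = 0" "f (X $ 3 - X $ 1) = 0"
        by (simp_all add: coordX)
      with x show "f x = 0" by auto
    qed simp
    have "x \<in> span ?E" for x
    proof -
      have "x = (coord X 1 x + coord X 3 x) *\<^sub>R X $ 1 + coord X 2 x *\<^sub>R X $ 2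
          + coord X 3 x *\<^sub>R (X $ 3 - X $ 1)"
        by (subst (1) decomp[of x]) (simp add: algebra_simps)
      moreover have "\<dots> \<in> span ?E"
        by (intro span_add span_scale span_base) auto
      ultimately show ?thesis by metis
    qed
    then show "span ?E = UNIV" by auto
    note ric_lin = bilinear_lsub[OF ric_bil] bilinear_rsub[OF ric_bil]
    show "\<forall>x\<in>?E. \<forall>y\<in>?E. x \<noteq> y \<longrightarrow> ricci g x y = 0"
      by (simp add: ric_lin ricX)
    \<comment> \<open>By orthogonality this is the (3,3) value minus the (1,1) value,
      \<open>- (8 * (v - u) / p)\<close>, and the factor \<open>p\<close> cancels.\<close>
    have neg: "ricci g (X $ 3 - X $ 1) (X $ 3 - X $ 1) = - 8"
      using ne by (simp add: ric_lin ricX uv field_simps)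
    have "sgn (ricci g (X $ 1) (X $ 1)) = 1" "sgn (ricci g (X $ 2) (X $ 2)) = - 1"
      using pq assms(2) by (simp_all add: ricX sgn_1_pos sgn_1_neg)
    then show "{#1, -1, -1#} = image_mset (\<lambda>x. sgn (ricci g x x)) (mset_set ?E)"
      using distinct neg by simp
  qed simp
  with g gram scal show ?thesis by blast
qed

end
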